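(* Let $n,m$ be positive integers, let $\rho:GL(n,\mathbb{C})\to GL(V_\rho)$ be a finite dimensional holomorphic representation of $GL(n,\mathbb{C})$ on a finite dimensional complex vector space $V_\rho$, and let $\chi:\mathbb{C}^{(m,m)}\to\mathbb{C}^\times$ be a character of the additive group $\mathbb{C}^{(m,m)}$. Then the mapping $J_\rho:\tilde G\times H_n\to GL(V_\rho)$ defined by $$J_\rho(\tilde\sigma,Z):=\rho(a(\tilde\sigma;Z)),\qquad \tilde\sigma\in\tilde G,\ Z\in H_n,$$ is a factor of automorphy for $\tilde G$. Furthermore, the mapping $$J_{\chi,\rho}(g,(Z,W)):=\chi(c(g;Z,W))\,\rho(a(g;Z)),\qquad g\in G^J,\ (Z,W)\in H_{n,m},$$ is a factor of automorphy for the Jacobi group $G^J$.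
   Context: Notation. $F^{(k,l)}$ denotes $k\times l$ matrices over $F$; ${}^tA$ is the transpose; $E_k$ is the identity matrix. $H_k=\{Z\in\mathbb{C}^{(k,k)}:Z={}^tZ,\ \mathrm{Im}\,Z>0\}$ is the Siegel upper half plane, on which $Sp(k,\mathbb{R})=\{M:{}^tMJ_kM=J_k\}$, $J_k=\begin{pmatrix}0&E_k\\-E_k&0\end{pmatrix}$, acts by $\begin{pmatrix}A&B\\C&D\end{pmatrix}\cdot Z=(AZ+B)(CZ+D)^{-1}$. $H_{n,m}:=H_n\times\mathbb{C}^{(m,n)}$. The Jacobi group $G^J$ is the subgroup of $Sp(m+n,\mathbb{R})$ (identified with its image in $Sp(m+n,\mathbb{R})/\{\pm E_{2(m+n)}\}$, the automorphism group of $H_{m+n}$) consisting of all matrices in $Sp(m+n,\mathbb{R})$ of the form $$[\sigma,E_m,(\lambda,\mu,\kappa)]=\begin{pmatrix}A&0&B&A\,{}^t\mu-B\,{}^t\lambda\\ \lambda&E_m&\mu&\kappa\\ C&0&D&C\,{}^t\mu-D\,{}^t\lambda\\ 0&0&0&E_m\end{pmatrix},$$ with $\sigma=\begin{pmatrix}A&B\\C&D\end{pmatrix}\in Sp(n,\mathbb{R})$, $\lambda,\mu\in\mathbb{R}^{(m,n)}$, $\kappa\in\mathbb{R}^{(m,m)}$. Write $(Z,W,T):=\begin{pmatrix}Z&{}^tW\\ W&T\end{pmatrix}\in H_{m+n}$ with $Z\in H_n$, $W\in\mathbb{C}^{(m,n)}$, $T\in H_m$. For $g\in G^J$ the symplectic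 action on $H_{m+n}$ has the form $$g\cdot(Z,W,T)=(\sigma_g(Z),\ a(g;Z)(W)+b(g;Z),\ T+c(g;Z,W)),$$ with $\sigma_g$ an automorphism of $H_n$, $a(g;\cdot):H_n\to GL(\mathbb{C}^{(m,n)})$, $b(g;\cdot):H_n\to\mathbb{C}^{(m,n)}$ and $c(g;\cdot,\cdot):H_n\times\mathbb{C}^{(m,n)}\to\mathbb{C}^{(m,m)}$ holomorphic; this defines $a,b,c$. $G^J$ acts on $H_{n,m}$ by $g\cdot(Z,W)=(\sigma_g(Z),a(g;Z)(W)+b(g;Z))$ and on $H_n$ by $g\cdot Z=\sigma_g(Z)$. $\tilde G$ is the subgroup of $G^J$ of elements $g$ whose action has the form $(Z,W,T)\mapsto(\sigma_g(Z),a(g;Z)(W),T+c(g;Z,W))$ with $c(g;Z,0)=0$. $K_{\mathbb{C}}\subset GL(\mathbb{C}^{(m,n)})$ is the complex Lie group generated by the linear maps $a(g;Z)$, $g\in G^J$, $Z\in H_n$. It is isomorphic to $GL(n,\mathbb{C})$; one fixes such an isomorphism of complex Lie groups and regards $\rho$ as a representation of $K_{\mathbb{C}}$ through it, so that $\rho(a(g;Z))$ makes sense. A factor of automorphy for a group $G$ acting on a space $X$, with values in a group $L$, is a map $J:G\times X\to L$ with $J(g_1g_2,x)=J(g_1,g_2\cdot x)\,J(g_2,x)$ for all $g_1,g_2\in G$, $x\in X$. Here $X=H_n$ for $\tilde G$ and $X=H_{n,m}$ for $G^J$. *)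

theory Defs
  imports "HOL-Analysis.Analysis" "HOL-Algebra.Generated_Groups"
begin

text \<open>
  The sizes \<open>n, m \<ge> 1\<close> are the cardinalities of finite index types \<open>'n\<close>, \<open>'m\<close>;
  a \<open>k \<times> l\<close> matrix over \<open>F\<close> has type \<open>F ^ 'l ^ 'k\<close>, and block matrices are
  indexed by sum types.
\<close>

definition block_mat ::
    "'a ^ 'k ^ 'r \<Rightarrow> 'a ^ 'l ^ 'r \<Rightarrow> 'a ^ 'k ^ 's \<Rightarrow> 'a ^ 'l ^ 's \<Rightarrow>
     'a ^ ('k::finite + 'l::finite) ^ ('r::finite + 's::finite)"
  where "block_mat A B C D =
    (\<chi> i j. case i of
        Inl p \<Rightarrow> (case j of Inl q \<Rightarrow> A $ p $ q | Inr q \<Rightarrow> B $ p $ q)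
      | Inr p \<Rightarrow> (case j of Inl q \<Rightarrow> C $ p $ q | Inr q \<Rightarrow> D $ p $ q))"

definition blk11 :: "'a ^ ('k::finite + 'l::finite) ^ ('r::finite + 's::finite) \<Rightarrow> 'a ^ 'k ^ 'r"
  where "blk11 M = (\<chi> i j. M $ Inl i $ Inl j)"

definition blk12 :: "'a ^ ('k::finite + 'l::finite) ^ ('r::finite + 's::finite) \<Rightarrow> 'a ^ 'l ^ 'r"
  where "blk12 M = (\<chi> i j. M $ Inl i $ Inr j)"

definition blk21 :: "'a ^ ('k::finite + 'l::finite) ^ ('r::finite + 's::finite) \<Rightarrow> 'a ^ 'k ^ 's"
  where "blk21 M = (\<chi> i j. M $ Inr i $ Inl j)"

definition blk22 :: "'a ^ ('k::finite + 'l::finite) ^ ('r::finite + 's::finite) \<Rightarrow> 'a ^ 'l ^ 's"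
  where "blk22 M = (\<chi> i j. M $ Inr i $ Inr j)"


subsection \<open>The symplectic group and the Siegel upper half plane\<close>

definition symplectic_form :: "real ^ ('k::finite + 'k) ^ ('k + 'k)"
  where "symplectic_form = block_mat 0 (mat 1) (- mat 1) 0"

definition symplectic_group :: "(real ^ ('k::finite + 'k) ^ ('k + 'k)) monoid"
  where "symplectic_group =
    \<lparr>carrier = {M. transpose M ** symplectic_form ** M = symplectic_form},
     mult = (**), one = mat 1\<rparr>"

definition siegel_upper :: "(complex ^ 'k ^ 'k::finite) set"
  where "siegel_upper =
    {Z. transpose Z = Z \<and> (\<forall>x::real ^ 'k. x \<noteq> 0 \<longrightarrow> x \<bullet> (map_matrix Im Z *v x) > 0)}"

definition siegel_act ::
    "real ^ ('k::finite + 'k) ^ ('k + 'k) \<Rightarrow> complex ^ 'k ^ 'k \<Rightarrow> complex ^ 'k ^ 'k"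
  where "siegel_act M Z =
    (let A = map_matrix complex_of_real (blk11 M); B = map_matrix complex_of_real (blk12 M);
         C = map_matrix complex_of_real (blk21 M); D = map_matrix complex_of_real (blk22 M)
     in (A ** Z + B) ** matrix_inv (C ** Z + D))"


subsection \<open>The Jacobi group\<close>

type_synonym ('n, 'm) jacobi_matrix = "real ^ (('n + 'm) + ('n + 'm)) ^ (('n + 'm) + ('n + 'm))"

definition jacobi_mat ::
    "real ^ ('n::finite + 'n) ^ ('n + 'n) \<Rightarrow> real ^ 'n ^ 'm::finite \<Rightarrow> real ^ 'n ^ 'm \<Rightarrow> real ^ 'm ^ 'm \<Rightarrow>
     ('n, 'm) jacobi_matrix"
  where "jacobi_mat \<sigma> lam mu kappa =
    (let A = blk11 \<sigma>; B = blk12 \<sigma>; C = blk21 \<sigma>; D = blk22 \<sigma>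
     in block_mat
          (block_mat A 0 lam (mat 1))
          (block_mat B (A ** transpose mu - B ** transpose lam) mu kappa)
          (block_mat C 0 0 0)
          (block_mat D (C ** transpose mu - D ** transpose lam) 0 (mat 1)))"

text \<open>
  \<open>- E\<close> does not have the form \<open>jacobi_mat \<dots>\<close>, so the Jacobi group embeds into
  the quotient of the symplectic group by \<open>{E, - E}\<close>; we work with the matrices.
\<close>

definition jacobi_group ::
    "('n::finite, 'm::finite) jacobi_matrix monoid"
  where "jacobi_group = symplectic_group
    \<lparr>carrier := {M \<in> carrier symplectic_group.
       \<exists>\<sigma> \<in> carrier symplectic_group. \<exists>lam mu kappa. M = jacobi_mat \<sigma> lam mu kappa}\<rparr>"

definition siegel_point ::
    "complex ^ 'n ^ 'n \<Rightarrow> complex ^ 'n ^ 'm \<Rightarrow> complex ^ 'm ^ 'm \<Rightarrow>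
     complex ^ ('n::finite + 'm::finite) ^ ('n + 'm)"
  where "siegel_point Z W T = block_mat Z (transpose W) W T"

definition jacobi_space :: "((complex ^ 'n ^ 'n::finite) \<times> (complex ^ 'n ^ 'm::finite)) set"
  where "jacobi_space = siegel_upper \<times> UNIV"


subsection \<open>Complex linear groups\<close>

definition cscale :: "complex \<Rightarrow> complex ^ 'l ^ 'k \<Rightarrow> complex ^ 'l::finite ^ 'k::finite"
  where "cscale z A = map_matrix ((*) z) A"

definition GL_n :: "(complex ^ 'n ^ 'n::finite) monoid"
  where "GL_n = \<lparr>carrier = {A. invertible A}, mult = (**), one = mat 1\<rparr>"

text \<open>
  Operators on \<open>\<complex>\<^bsup>(m,n)\<^esup>\<close> are elements of the normed space of bounded real-linear
  operators; complex linearity is imposed separately.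
\<close>

type_synonym ('n, 'm) mat_op = "(complex ^ 'n ^ 'm) \<Rightarrow>\<^sub>L (complex ^ 'n ^ 'm)"

definition GL_mat :: "('n::finite, 'm::finite) mat_op monoid"
  where "GL_mat =
    \<lparr>carrier = {L. (\<forall>z W. blinfun_apply L (cscale z W) = cscale z (blinfun_apply L W)) \<and>
                   bij (blinfun_apply L)},
     mult = (o\<^sub>L), one = id_blinfun\<rparr>"

definition GL_space :: "(complex \<Rightarrow> 'v \<Rightarrow> 'v) \<Rightarrow> ('v::ab_group_add \<Rightarrow> 'v) monoid"
  where "GL_space s =
    \<lparr>carrier = {f. Vector_Spaces.linear s s f \<and> bij f}, mult = (\<circ>), one = id\<rparr>"


subsection \<open>The data \<open>\<sigma>\<^sub>g, a, b, c\<close> of the action of the Jacobi group\<close>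

definition jacobi_decomposition ::
    "('n::finite, 'm::finite) jacobi_matrix \<Rightarrow>
     (complex ^ 'n ^ 'n \<Rightarrow> complex ^ 'n ^ 'n) \<Rightarrow>
     (complex ^ 'n ^ 'n \<Rightarrow> ('n, 'm) mat_op) \<Rightarrow>
     (complex ^ 'n ^ 'n \<Rightarrow> complex ^ 'n ^ 'm) \<Rightarrow>
     (complex ^ 'n ^ 'n \<Rightarrow> complex ^ 'n ^ 'm \<Rightarrow> complex ^ 'm ^ 'm) \<Rightarrow> bool"
  where "jacobi_decomposition g s a b c \<longleftrightarrow>
    (\<forall>Z \<in> siegel_upper. a Z \<in> carrier GL_mat) \<and>
    (\<forall>Z W T. siegel_point Z W T \<in> siegel_upper \<longrightarrow>
       siegel_act g (siegel_point Z W T) =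
       siegel_point (s Z) (blinfun_apply (a Z) W + b Z) (T + c Z W))"

text \<open>
  For \<open>g\<close> in the Jacobi group a decomposition exists, and its values at \<open>Z\<close> in the
  Siegel upper half plane are unique: given \<open>Z\<close> and \<open>W\<close>, the point \<open>(Z, W, T)\<close> lies in
  the half plane as soon as the imaginary part of \<open>T\<close> is large enough, and \<open>a Z\<close> is
  linear. Hence the choice below is immaterial. In particular these values are
  automatically holomorphic, and \<open>s\<close> is automatically an automorphism of the half plane.
\<close>

definition jacobi_data ::
    "('n::finite, 'm::finite) jacobi_matrix \<Rightarrow>
     (complex ^ 'n ^ 'n \<Rightarrow> complex ^ 'n ^ 'n) \<times>
     (complex ^ 'n ^ 'n \<Rightarrow> ('n, 'm) mat_op) \<times>
     (complex ^ 'n ^ 'n \<Rightarrow> complex ^ 'n ^ 'm) \<times>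
     (complex ^ 'n ^ 'n \<Rightarrow> complex ^ 'n ^ 'm \<Rightarrow> complex ^ 'm ^ 'm)"
  where "jacobi_data g = (SOME (s, a, b, c). jacobi_decomposition g s a b c)"

definition jacobi_sigma ::
    "('n::finite, 'm::finite) jacobi_matrix \<Rightarrow>
     complex ^ 'n ^ 'n \<Rightarrow> complex ^ 'n ^ 'n"
  where "jacobi_sigma g = (case jacobi_data g of (s, a, b, c) \<Rightarrow> s)"

definition jacobi_a ::
    "('n::finite, 'm::finite) jacobi_matrix \<Rightarrow>
     complex ^ 'n ^ 'n \<Rightarrow> ('n, 'm) mat_op"
  where "jacobi_a g = (case jacobi_data g of (s, a, b, c) \<Rightarrow> a)"

definition jacobi_b ::
    "('n::finite, 'm::finite) jacobi_matrix \<Rightarrow>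
     complex ^ 'n ^ 'n \<Rightarrow> complex ^ 'n ^ 'm"
  where "jacobi_b g = (case jacobi_data g of (s, a, b, c) \<Rightarrow> b)"

definition jacobi_c ::
    "('n::finite, 'm::finite) jacobi_matrix \<Rightarrow>
     complex ^ 'n ^ 'n \<Rightarrow> complex ^ 'n ^ 'm \<Rightarrow> complex ^ 'm ^ 'm"
  where "jacobi_c g = (case jacobi_data g of (s, a, b, c) \<Rightarrow> c)"

definition jacobi_act ::
    "('n::finite, 'm::finite) jacobi_matrix \<Rightarrow>
     (complex ^ 'n ^ 'n) \<times> (complex ^ 'n ^ 'm) \<Rightarrow> (complex ^ 'n ^ 'n) \<times> (complex ^ 'n ^ 'm)"
  where "jacobi_act g =
    (\<lambda>(Z, W). (jacobi_sigma g Z, blinfun_apply (jacobi_a g Z) W + jacobi_b g Z))"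

definition tilde_group ::
    "('n::finite, 'm::finite) jacobi_matrix monoid"
  where "tilde_group = jacobi_group
    \<lparr>carrier := {g \<in> carrier jacobi_group.
       (\<forall>Z W T. siegel_point Z W T \<in> siegel_upper \<longrightarrow>
          siegel_act g (siegel_point Z W T) =
          siegel_point (jacobi_sigma g Z) (blinfun_apply (jacobi_a g Z) W) (T + jacobi_c g Z W)) \<and>
       (\<forall>Z \<in> siegel_upper. jacobi_c g Z 0 = 0)}\<rparr>"

text \<open>
  The abstract subgroup generated by the operators \<open>a(g;Z)\<close> already consists of all
  right multiplications by invertible complex matrices, so it is a complex Lie group and
  no closure is needed.
\<close>

definition K_complex :: "('n::finite, 'm::finite) mat_op monoid"
  where "K_complex = GL_mat
    \<lparr>carrier := generate GL_mat
       {jacobi_a g Z | g Z. g \<in> carrier jacobi_group \<and> Z \<in> siegel_upper}\<rparr>"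


subsection \<open>Holomorphic maps, representations and factors of automorphy\<close>

text \<open>
  Holomorphy of a map between (possibly not open) subsets of finite dimensional complex
  vector spaces with complex scalar multiplications \<open>s\<close> and \<open>t\<close>: locally the map is the
  restriction of a map on an open set that is Frechet differentiable with complex linear
  derivatives. On open sets and on complex submanifolds this is the usual notion.
\<close>

definition holomorphic_map_on ::
    "(complex \<Rightarrow> 'a::real_normed_vector \<Rightarrow> 'a) \<Rightarrow> (complex \<Rightarrow> 'b::real_normed_vector \<Rightarrow> 'b) \<Rightarrow>
     ('a \<Rightarrow> 'b) \<Rightarrow> 'a set \<Rightarrow> bool"
  where "holomorphic_map_on s t f S \<longleftrightarrow>
    (\<forall>x \<in> S. \<exists>U F. open U \<and> x \<in> U \<and> (\<forall>y \<in> S \<inter> U. F y = f y) \<and>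
       (\<forall>y \<in> U. \<exists>F'. (F has_derivative F') (at y) \<and> (\<forall>z v. F' (s z v) = t z (F' v))))"

definition op_cscale :: "complex \<Rightarrow> ('n::finite, 'm::finite) mat_op \<Rightarrow> ('n, 'm) mat_op"
  where "op_cscale z L = Blinfun (\<lambda>W. cscale z (blinfun_apply L W))"

definition K_lie_iso :: "(('n::finite, 'm::finite) mat_op \<Rightarrow> complex ^ 'n ^ 'n) \<Rightarrow> bool"
  where "K_lie_iso \<Phi> \<longleftrightarrow>
    \<Phi> \<in> iso K_complex GL_n \<and>
    holomorphic_map_on op_cscale cscale \<Phi> (carrier K_complex) \<and>
    holomorphic_map_on cscale op_cscale (inv_into (carrier K_complex) \<Phi>) (carrier GL_n)"

text \<open>
  Holomorphy of a representation is expressed through its matrix coefficients, which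
  avoids choosing a norm on the representation space.
\<close>

definition holomorphic_rep ::
    "(complex \<Rightarrow> 'v::ab_group_add \<Rightarrow> 'v) \<Rightarrow> (complex ^ 'n ^ 'n::finite \<Rightarrow> 'v \<Rightarrow> 'v) \<Rightarrow> bool"
  where "holomorphic_rep s \<rho> \<longleftrightarrow>
    \<rho> \<in> hom GL_n (GL_space s) \<and>
    (\<forall>v l. Vector_Spaces.linear s (*) l \<longrightarrow>
       holomorphic_map_on cscale (*) (\<lambda>P. l (\<rho> P v)) (carrier GL_n))"

definition additive_character :: "(complex ^ 'm ^ 'm::finite \<Rightarrow> complex) \<Rightarrow> bool"
  where "additive_character chi \<longleftrightarrow>
    (\<forall>T. chi T \<noteq> 0) \<and> (\<forall>S T. chi (S + T) = chi S * chi T)"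

definition factor_of_automorphy ::
    "('g, 'r) monoid_scheme \<Rightarrow> 'x set \<Rightarrow> ('g \<Rightarrow> 'x \<Rightarrow> 'x) \<Rightarrow> ('l, 'q) monoid_scheme \<Rightarrow>
     ('g \<Rightarrow> 'x \<Rightarrow> 'l) \<Rightarrow> bool"
  where "factor_of_automorphy G X act L J \<longleftrightarrow>
    (\<forall>g \<in> carrier G. \<forall>x \<in> X. J g x \<in> carrier L) \<and>
    (\<forall>g1 \<in> carrier G. \<forall>g2 \<in> carrier G. \<forall>x \<in> X.
       J (g1 \<otimes>\<^bsub>G\<^esub> g2) x = J g1 (act g2 x) \<otimes>\<^bsub>L\<^esub> J g2 x)"

end

theory Submission
  imports Defs
begin

text \<open>
  The symplectic action on the big half plane is a group action, and it is compatible with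
  the fibration \<open>(Z, W, T) \<mapsto> (Z, W) \<mapsto> Z\<close>. Applying two elements of the Jacobi group in
  succession therefore composes their data:
  \<open>T\<close> is first translated by \<open>c(g\<^sub>2; Z, W)\<close> and then by \<open>c(g\<^sub>1; g\<^sub>2 \<cdot> (Z, W))\<close>, while the linear part
  in \<open>W\<close> becomes \<open>a(g\<^sub>1; g\<^sub>2 \<cdot> Z) a(g\<^sub>2; Z)\<close>. So \<open>c\<close> is an additive cocycle and \<open>a\<close> a
  multiplicative one (\<open>jacobi_cocycle\<close>). A character turns the former into a multiplicative
  scalar cocycle, a representation preserves the latter, and scalars commute with linear
  maps; this gives both factors of automorphy.

  The cocycle relations need three facts. The data of an element must be unique, which
  holds because above every \<open>(Z, W)\<close> there is a point of the half plane
  (\<open>siegel_point_upper_exists\<close>). They must exist, which is an explicit calculation with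
  blocks (\<open>jacobi_decomposition_exists\<close>). Finally, fractional linear transformations must
  act on the Siegel half plane: denominators are invertible, the half plane is preserved,
  and products act by composition. All this rests on the bilinear identity
  \<open>siegel_bilinear_identity\<close>, which expresses the preservation of the symplectic form on
  the columns \<open>(Z, E)\<close>.
\<close>

section \<open>Block matrices\<close>

lemma sum_UNIV_Plus:
  fixes f :: "'a::finite + 'b::finite \<Rightarrow> 'c::comm_monoid_add"
  shows "sum f UNIV = (\<Sum>i\<in>UNIV. f (Inl i)) + (\<Sum>j\<in>UNIV. f (Inr j))"
  by (subst UNIV_Plus_UNIV[symmetric], subst sum.Plus) auto

lemma block_mat_nth [simp]:
  "block_mat A B C D $ Inl i $ Inl j = A $ i $ j"
  "block_mat A B C D $ Inl i $ Inr j' = B $ i $ j'"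
  "block_mat A B C D $ Inr i' $ Inl j = C $ i' $ j"
  "block_mat A B C D $ Inr i' $ Inr j' = D $ i' $ j'"
  by (simp_all add: block_mat_def)

lemma forall_Plus: "(\<forall>i. P i) \<longleftrightarrow> (\<forall>a. P (Inl a)) \<and> (\<forall>b. P (Inr b))"
  by (metis sum.exhaust)

lemma block_mat_eqI:
  assumes "blk11 M = blk11 N" "blk12 M = blk12 N" "blk21 M = blk21 N" "blk22 M = blk22 N"
  shows "M = N"
  using assms by (simp add: vec_eq_iff forall_Plus blk11_def blk12_def blk21_def blk22_def)

lemma blk_block_mat [simp]:
  "blk11 (block_mat A B C D) = A" "blk12 (block_mat A B C D) = B"
  "blk21 (block_mat A B C D) = C" "blk22 (block_mat A B C D) = D"
  by (simp_all add: vec_eq_iff blk11_def blk12_def blk21_def blk22_def)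

lemma blk_mult:
  "blk11 (M ** N) = blk11 M ** blk11 N + blk12 M ** blk21 N"
  "blk12 (M ** N) = blk11 M ** blk12 N + blk12 M ** blk22 N"
  "blk21 (M ** N) = blk21 M ** blk11 N + blk22 M ** blk21 N"
  "blk22 (M ** N) = blk21 M ** blk12 N + blk22 M ** blk22 N"
  by (simp_all add: vec_eq_iff blk11_def blk12_def blk21_def blk22_def
      matrix_matrix_mult_def sum_UNIV_Plus)

lemma blk_add:
  "blk11 (M + N) = blk11 M + blk11 N" "blk12 (M + N) = blk12 M + blk12 N"
  "blk21 (M + N) = blk21 M + blk21 N" "blk22 (M + N) = blk22 M + blk22 N"
  by (simp_all add: vec_eq_iff blk11_def blk12_def blk21_def blk22_def)

lemma blk_transpose:
  "blk11 (transpose M) = transpose (blk11 M)" "blk12 (transpose M) = transpose (blk21 M)"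
  "blk21 (transpose M) = transpose (blk12 M)" "blk22 (transpose M) = transpose (blk22 M)"
  by (simp_all add: vec_eq_iff blk11_def blk12_def blk21_def blk22_def transpose_def)

lemma blk_map_matrix:
  "blk11 (map_matrix f M) = map_matrix f (blk11 M)" "blk12 (map_matrix f M) = map_matrix f (blk12 M)"
  "blk21 (map_matrix f M) = map_matrix f (blk21 M)" "blk22 (map_matrix f M) = map_matrix f (blk22 M)"
  by (simp_all add: vec_eq_iff blk11_def blk12_def blk21_def blk22_def)


section \<open>Matrix algebra\<close>

lemma matrix_add_rdistrib: "(A + B) ** C = A ** C + B ** (C :: 'a::semiring_1 ^ 'p ^ 'n)"
  by (simp add: vec_eq_iff matrix_matrix_mult_def sum.distrib distrib_right)

lemma matrix_diff_ldistrib: "A ** (B - C) = A ** B - A ** (C :: 'a::ring_1 ^ 'p ^ 'n)"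
  by (simp add: vec_eq_iff matrix_matrix_mult_def sum_subtractf right_diff_distrib)

lemma matrix_diff_rdistrib: "(A - B) ** C = A ** C - B ** (C :: 'a::ring_1 ^ 'p ^ 'n)"
  by (simp add: vec_eq_iff matrix_matrix_mult_def sum_subtractf left_diff_distrib)

lemma matrix_minus_left: "(- A) ** C = - (A ** (C :: 'a::ring_1 ^ 'p ^ 'n))"
  by (simp add: vec_eq_iff matrix_matrix_mult_def sum_negf)

lemma matrix_minus_right: "A ** (- C) = - (A ** (C :: 'a::ring_1 ^ 'p ^ 'n))"
  by (simp add: vec_eq_iff matrix_matrix_mult_def sum_negf)

lemma transpose_add: "transpose (A + B) = transpose A + transpose B"
  by (simp add: vec_eq_iff transpose_def)

lemma matrix_inv:
  fixes A :: "'a::semiring_1 ^ 'n ^ 'm"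
  assumes "invertible A"
  shows "A ** matrix_inv A = mat 1" "matrix_inv A ** A = mat 1"
  using someI_ex[OF assms[unfolded invertible_def]] by (simp_all add: matrix_inv_def)

lemma eq_mult_matrix_inv:
  fixes A :: "'a::semiring_1 ^ 'n ^ 'm"
  assumes "invertible A" "X ** A = B"
  shows "X = B ** matrix_inv A"
  using assms by (metis matrix_inv(1) matrix_mul_assoc matrix_mul_rid)

abbreviation cmat :: "real ^ 'k ^ 'l \<Rightarrow> complex ^ 'k ^ 'l" where
  "cmat \<equiv> map_matrix complex_of_real"

lemma cmat_hom:
  "cmat (A ** B) = cmat A ** cmat B" "cmat (P + Q) = cmat P + cmat Q"
  "cmat (mat 1) = mat 1" "cmat 0 = 0" "transpose (cmat P) = cmat (transpose P)"
  "map_matrix cnj (cmat P) = cmat P"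
  by (simp_all add: vec_eq_iff matrix_matrix_mult_def mat_def transpose_def)

lemma map_cnj_hom:
  "map_matrix cnj (A ** B) = map_matrix cnj A ** map_matrix cnj B"
  "map_matrix cnj (P + Q) = map_matrix cnj P + map_matrix cnj Q"
  by (simp_all add: vec_eq_iff matrix_matrix_mult_def)


section \<open>The action of the symplectic group on the Siegel upper half plane\<close>

definition siegel_num :: "real ^ ('k::finite + 'k) ^ ('k + 'k) \<Rightarrow> complex ^ 'k ^ 'k \<Rightarrow> complex ^ 'k ^ 'k"
  where "siegel_num M Z = cmat (blk11 M) ** Z + cmat (blk12 M)"

definition siegel_den :: "real ^ ('k::finite + 'k) ^ ('k + 'k) \<Rightarrow> complex ^ 'k ^ 'k \<Rightarrow> complex ^ 'k ^ 'k"
  where "siegel_den M Z = cmat (blk21 M) ** Z + cmat (blk22 M)"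

lemma siegel_act_quotient: "siegel_act M Z = siegel_num M Z ** matrix_inv (siegel_den M Z)"
  by (simp add: siegel_act_def siegel_num_def siegel_den_def)

lemma symplectic_block_relations:
  fixes M :: "real ^ ('k::finite + 'k) ^ ('k + 'k)"
  assumes "M \<in> carrier symplectic_group"
  defines "A \<equiv> blk11 M" and "B \<equiv> blk12 M" and "C \<equiv> blk21 M" and "D \<equiv> blk22 M"
  shows "transpose A ** C = transpose C ** A"
    and "transpose A ** D = mat 1 + transpose C ** B"
    and "transpose D ** A = mat 1 + transpose B ** C"
    and "transpose B ** D = transpose D ** B"
proof -
  have M: "transpose M ** symplectic_form ** M = symplectic_form"
    using assms by (simp add: symplectic_group_def)
  note eqs = arg_cong[OF M, of blk11] arg_cong[OF M, of blk12]
    arg_cong[OF M, of blk21] arg_cong[OF M, of blk22]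
  note eqs' = eqs[unfolded blk_mult blk_transpose symplectic_form_def blk_block_mat]
  show "transpose A ** C = transpose C ** A" "transpose A ** D = mat 1 + transpose C ** B"
    "transpose D ** A = mat 1 + transpose B ** C" "transpose B ** D = transpose D ** B"
    using eqs' unfolding A_def B_def C_def D_def
    by (simp_all add: matrix_minus_left matrix_minus_right diff_eq_eq eq_diff_eq minus_equation_iff algebra_simps)
qed

text \<open>
  Both sides are values of the symplectic form: on the columns \<open>M (Z\<^sub>1, E)\<close>, \<open>M (Z\<^sub>2, E)\<close> and on
  \<open>(Z\<^sub>1, E)\<close>, \<open>(Z\<^sub>2, E)\<close>. For \<open>Z\<^sub>1 = Z\<^sub>2 = Z\<close> symmetric this yields the symmetry of \<open>M \<cdot> Z\<close>; for
  \<open>Z\<^sub>1\<close> the conjugate of \<open>Z\<^sub>2\<close> it yields the positivity of its imaginary part.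
\<close>

lemma siegel_bilinear_identity:
  assumes M: "M \<in> carrier symplectic_group"
  shows "transpose (siegel_num M Z1) ** siegel_den M Z2 - transpose (siegel_den M Z1) ** siegel_num M Z2
    = transpose Z1 - Z2"
proof -
  define A B C D where "A = cmat (blk11 M)" "B = cmat (blk12 M)" "C = cmat (blk21 M)" "D = cmat (blk22 M)"
  note r = symplectic_block_relations[OF M, THEN arg_cong, of cmat, unfolded cmat_hom cmat_hom(5)[symmetric]
    A_B_C_D_def[symmetric]]
  have "transpose (siegel_num M Z1) ** siegel_den M Z2 - transpose (siegel_den M Z1) ** siegel_num M Z2
    = transpose Z1 ** (transpose A ** C - transpose C ** A) ** Z2
      + transpose Z1 ** (transpose A ** D - transpose C ** B)
      + (transpose B ** C - transpose D ** A) ** Z2 + (transpose B ** D - transpose D ** B)"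
    unfolding siegel_num_def siegel_den_def A_B_C_D_def[symmetric]
    by (simp add: transpose_add matrix_transpose_mul matrix_add_ldistrib matrix_add_rdistrib
        matrix_diff_ldistrib matrix_diff_rdistrib matrix_mul_assoc)
  also have "\<dots> = transpose Z1 - Z2"
    by (simp add: r matrix_minus_left)
  finally show ?thesis .
qed

definition hpair :: "complex ^ 'k \<Rightarrow> complex ^ 'k \<Rightarrow> complex"
  where "hpair u v = (\<Sum>i\<in>UNIV. cnj (u $ i) * v $ i)"

lemma hpair_matrix: "hpair (A *v u) v = hpair u (transpose (map_matrix cnj A) *v v)"
proof -
  have "hpair (A *v u) v = (\<Sum>i\<in>UNIV. \<Sum>j\<in>UNIV. cnj (A $ i $ j) * cnj (u $ j) * v $ i)"
    by (simp add: hpair_def matrix_vector_mult_def sum_distrib_right)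
  also have "\<dots> = (\<Sum>j\<in>UNIV. \<Sum>i\<in>UNIV. cnj (A $ i $ j) * cnj (u $ j) * v $ i)"
    by (rule sum.swap)
  also have "\<dots> = hpair u (transpose (map_matrix cnj A) *v v)"
    unfolding hpair_def matrix_vector_mult_def transpose_def
    by (simp add: sum_distrib_left mult_ac)
  finally show ?thesis .
qed

lemma hpair_diff: "hpair u (v - w) = hpair u v - hpair u w"
  by (simp add: hpair_def right_diff_distrib sum_subtractf)

lemma Im_hpair_swap: "Im (hpair v u) = - Im (hpair u v)"
  by (simp add: hpair_def sum_negf[symmetric] mult.commute)

text \<open>
  For symmetric \<open>Z\<close> the mixed terms in the real and imaginary parts of \<open>u\<close> cancel in
  \<open>Im (hpair u (Z u))\<close>, so that positivity of \<open>Im Z\<close> on real vectors extends to this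
  hermitian form on complex ones. The complex version is needed because the denominator
  of a fractional linear transformation maps real vectors to complex ones.
\<close>

lemma siegel_upper_iff_hermitian:
  fixes Z :: "complex ^ 'k ^ 'k::finite"
  shows "Z \<in> siegel_upper \<longleftrightarrow> transpose Z = Z \<and> (\<forall>u. u \<noteq> 0 \<longrightarrow> Im (hpair u (Z *v u)) > 0)"
proof -
  have real_vec: "Im (hpair (\<chi> i. of_real (x $ i)) (Z *v (\<chi> i. of_real (x $ i)))) = x \<bullet> (map_matrix Im Z *v x)"
    for x :: "real ^ 'k"
    by (simp add: hpair_def inner_vec_def matrix_vector_mult_def)
  have "Im (hpair u (Z *v u)) = (\<chi> i. Re (u $ i)) \<bullet> (map_matrix Im Z *v (\<chi> i. Re (u $ i)))
      + (\<chi> i. Im (u $ i)) \<bullet> (map_matrix Im Z *v (\<chi> i. Im (u $ i)))"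
    if sym: "transpose Z = Z" for u :: "complex ^ 'k"
  proof -
    have s: "Z $ i $ j = Z $ j $ i" for i j
      using arg_cong[OF sym, of "\<lambda>X. X $ i $ j"] by (simp add: transpose_def)
    \<comment> \<open>The entries of \<open>f\<close> are the mixed terms; by symmetry of \<open>Z\<close> their sum is unchanged
      when the real and imaginary parts of \<open>u\<close> trade places.\<close>
    define f where "f i j = Re (Z $ i $ j) * (Re (u $ i) * Im (u $ j))" for i j
    have "(\<Sum>i\<in>UNIV. \<Sum>j\<in>UNIV. f i j) = (\<Sum>j\<in>UNIV. \<Sum>i\<in>UNIV. f i j)" by (rule sum.swap)
    also have "\<dots> = (\<Sum>i\<in>UNIV. \<Sum>j\<in>UNIV. Re (Z $ i $ j) * (Re (u $ j) * Im (u $ i)))"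
      unfolding f_def by (intro sum.cong refl) (simp add: s)
    finally show ?thesis unfolding f_def
      by (simp add: hpair_def inner_vec_def matrix_vector_mult_def sum_distrib_left sum_subtractf sum.distrib algebra_simps)
  qed
  moreover have "(\<chi> i. Re (u $ i)) \<noteq> 0 \<or> (\<chi> i. Im (u $ i)) \<noteq> 0" if "u \<noteq> 0" for u :: "complex ^ 'k"
    using that by (auto simp: vec_eq_iff complex_eq_iff)
  moreover have "(\<chi> i. complex_of_real (x $ i)) \<noteq> 0" if "x \<noteq> 0" for x :: "real ^ 'k"
    using that by (auto simp: vec_eq_iff)
  moreover have "0 \<bullet> (map_matrix Im Z *v 0) = 0" by simp
  ultimately show ?thesis unfolding siegel_upper_def
    by (smt (verit, best) mem_Collect_eq real_vec)
qed

text \<open>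
  With \<open>w\<close> the image of \<open>u\<close> under the denominator, the left hand side is the hermitian form of
  \<open>M \<cdot> Z\<close> at \<open>w\<close>. Hence positivity passes from \<open>Z\<close> to \<open>M \<cdot> Z\<close>; and a kernel vector of the
  denominator makes the form of \<open>Z\<close> vanish.
\<close>

lemma siegel_hermitian_identity:
  assumes M: "M \<in> carrier symplectic_group"
  shows "Im (hpair (siegel_den M Z *v u) (siegel_num M Z *v u)) = Im (hpair u (Z *v u))"
proof -
  have c: "map_matrix cnj (siegel_num M Z) = siegel_num M (map_matrix cnj Z)"
    "map_matrix cnj (siegel_den M Z) = siegel_den M (map_matrix cnj Z)"
    by (simp_all add: siegel_num_def siegel_den_def map_cnj_hom cmat_hom)
  have "hpair (siegel_num M Z *v u) (siegel_den M Z *v u) - hpair (siegel_den M Z *v u) (siegel_num M Z *v u)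
      = hpair u ((transpose (siegel_num M (map_matrix cnj Z)) ** siegel_den M Z
          - transpose (siegel_den M (map_matrix cnj Z)) ** siegel_num M Z) *v u)"
    by (simp only: hpair_matrix c matrix_vector_mul_assoc hpair_diff[symmetric] matrix_vector_mult_diff_rdistrib)
  also have "\<dots> = hpair (Z *v u) u - hpair u (Z *v u)"
    by (simp only: siegel_bilinear_identity[OF M] hpair_matrix hpair_diff matrix_vector_mult_diff_rdistrib)
  finally have "Im (hpair (siegel_num M Z *v u) (siegel_den M Z *v u) - hpair (siegel_den M Z *v u) (siegel_num M Z *v u))
    = Im (hpair (Z *v u) u - hpair u (Z *v u))" by simp
  then show ?thesis
    using Im_hpair_swap[of "siegel_den M Z *v u" "siegel_num M Z *v u"] Im_hpair_swap[of u "Z *v u"] by simp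
qed

lemma siegel_den_invertible:
  assumes M: "M \<in> carrier symplectic_group" and Z: "Z \<in> siegel_upper"
  shows "invertible (siegel_den M Z)"
  unfolding invertible_left_inverse matrix_left_invertible_ker
proof (intro allI impI)
  fix u assume "siegel_den M Z *v u = 0"
  then have "Im (hpair u (Z *v u)) = 0"
    using siegel_hermitian_identity[OF M, of Z u] by (simp add: hpair_def)
  then show "u = 0" using Z by (auto simp: siegel_upper_iff_hermitian)
qed

lemma siegel_act_den:
  assumes M: "M \<in> carrier symplectic_group" and Z: "Z \<in> siegel_upper"
  shows "siegel_act M Z ** siegel_den M Z = siegel_num M Z"
  by (simp add: siegel_act_quotient matrix_mul_assoc[symmetric]
      matrix_inv(2)[OF siegel_den_invertible[OF M Z]])

lemma siegel_act_in_upper: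
  assumes M: "M \<in> carrier symplectic_group" and Z: "Z \<in> siegel_upper"
  shows "siegel_act M Z \<in> siegel_upper"
proof -
  define P Q where "P = siegel_num M Z" "Q = siegel_den M Z"
  have inv: "invertible Q" using siegel_den_invertible[OF M Z] by (simp add: P_Q_def)
  define R where "R = matrix_inv Q"
  have QR: "Q ** R = mat 1" using matrix_inv[OF inv] by (simp add: R_def)
  have act: "siegel_act M Z = P ** R" by (simp add: siegel_act_quotient P_Q_def R_def)
  have "transpose P ** Q = transpose Q ** P"
    using siegel_bilinear_identity[OF M, of Z Z] Z by (simp add: P_Q_def siegel_upper_def)
  then have "transpose R ** (transpose P ** Q) ** R = transpose R ** (transpose Q ** P) ** R" by simp
  also have "\<dots> = transpose (Q ** R) ** P ** R" by (simp add: matrix_transpose_mul matrix_mul_assoc)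
  finally have sym: "transpose (P ** R) = P ** R"
    by (simp add: QR matrix_mul_assoc[symmetric] matrix_transpose_mul)
  have "Im (hpair w ((P ** R) *v w)) > 0" if "w \<noteq> 0" for w
  proof -
    have w: "Q *v (R *v w) = w" by (simp add: matrix_vector_mul_assoc QR)
    then have "R *v w \<noteq> 0" using that by auto
    then have "0 < Im (hpair (R *v w) (Z *v (R *v w)))" using Z by (simp add: siegel_upper_iff_hermitian)
    then show ?thesis
      using siegel_hermitian_identity[OF M, of Z "R *v w"]
      by (simp only: P_Q_def[symmetric] w) (simp add: matrix_vector_mul_assoc)
  qed
  with sym show ?thesis by (simp add: act siegel_upper_iff_hermitian)
qed

lemma siegel_act_mult:
  assumes M: "M \<in> carrier symplectic_group" and N: "N \<in> carrier symplectic_group"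
    and Z: "Z \<in> siegel_upper"
  shows "siegel_act (M ** N) Z = siegel_act M (siegel_act N Z)"
proof -
  let ?Y = "siegel_act N Z"
  have Y: "?Y \<in> siegel_upper" by (rule siegel_act_in_upper[OF N Z])
  \<comment> \<open>Both numerator and denominator of the product acquire the factor \<open>siegel_den N Z\<close>,
    which cancels in the quotient.\<close>
  have num: "siegel_num (M ** N) Z = siegel_num M ?Y ** siegel_den N Z"
    and den: "siegel_den (M ** N) Z = siegel_den M ?Y ** siegel_den N Z"
    using siegel_act_den[OF N Z]
    by (simp_all add: siegel_num_def[of M] siegel_den_def[of M] matrix_add_rdistrib
        matrix_mul_assoc[symmetric])
      (simp_all add: siegel_num_def siegel_den_def blk_mult cmat_hom matrix_add_rdistrib
        matrix_add_ldistrib matrix_mul_assoc add_ac)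
  have "invertible (siegel_den (M ** N) Z)"
    unfolding den by (intro invertible_mult siegel_den_invertible M N Y Z)
  moreover have "siegel_act M ?Y ** siegel_den (M ** N) Z = siegel_num (M ** N) Z"
    by (simp add: num den matrix_mul_assoc siegel_act_den[OF M Y])
  ultimately show ?thesis
    using eq_mult_matrix_inv siegel_act_quotient by metis
qed


section \<open>Points of the half plane in block form\<close>

definition vjoin :: "'a ^ 'k \<Rightarrow> 'a ^ 'l \<Rightarrow> 'a ^ ('k::finite + 'l::finite)"
  where "vjoin u v = (\<chi> i. case i of Inl p \<Rightarrow> u $ p | Inr q \<Rightarrow> v $ q)"

lemma vjoin_nth [simp]: "vjoin u v $ Inl p = u $ p" "vjoin u v $ Inr q = v $ q"
  by (simp_all add: vjoin_def)

lemma vjoin_cases: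
  obtains u v where "x = vjoin u v"
proof
  show "x = vjoin (\<chi> p. x $ Inl p) (\<chi> q. x $ Inr q)"
    by (simp add: vec_eq_iff forall_Plus)
qed

lemma vjoin_eq_0_iff: "vjoin u v = 0 \<longleftrightarrow> u = 0 \<and> v = 0"
  by (simp add: vec_eq_iff forall_Plus)

lemma inner_vjoin: "vjoin u v \<bullet> vjoin u' v' = u \<bullet> u' + v \<bullet> v'"
  by (simp add: inner_vec_def sum_UNIV_Plus)

lemma matrix_vjoin: "M *v vjoin u v = vjoin (blk11 M *v u + blk12 M *v v) (blk21 M *v u + blk22 M *v v)"
  by (simp add: vec_eq_iff forall_Plus matrix_vector_mult_def sum_UNIV_Plus
      blk11_def blk12_def blk21_def blk22_def)

lemma blk_siegel_point [simp]:
  "blk11 (siegel_point Z W T) = Z" "blk12 (siegel_point Z W T) = transpose W"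
  "blk21 (siegel_point Z W T) = W" "blk22 (siegel_point Z W T) = T"
  by (simp_all add: siegel_point_def)

lemma siegel_point_inject [simp]:
  "siegel_point Z W T = siegel_point Z' W' T' \<longleftrightarrow> Z = Z' \<and> W = W' \<and> T = T'"
  by (metis blk_siegel_point)

lemma siegel_point_sym_iff:
  "transpose (siegel_point Z W T) = siegel_point Z W T \<longleftrightarrow> transpose Z = Z \<and> transpose T = T"
proof
  assume "transpose (siegel_point Z W T) = siegel_point Z W T"
  then show "transpose Z = Z \<and> transpose T = T" by (metis blk_siegel_point blk_transpose)
qed (auto intro!: block_mat_eqI simp: blk_transpose)

lemma siegel_upper_eq_siegel_point:
  assumes "R \<in> siegel_upper"
  shows "R = siegel_point (blk11 R) (blk21 R) (blk22 R)"
proof -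
  have "transpose R = R" using assms by (simp add: siegel_upper_def)
  then have "blk12 R = transpose (blk21 R)" by (metis blk_transpose(2))
  then show ?thesis by (auto intro!: block_mat_eqI)
qed

lemma siegel_point_upper_left:
  fixes Z :: "complex ^ 'n ^ 'n::finite" and W :: "complex ^ 'n ^ 'm::finite"
  assumes P: "siegel_point Z W T \<in> siegel_upper"
  shows "Z \<in> siegel_upper"
proof -
  have "u \<bullet> (map_matrix Im Z *v u) > 0" if "u \<noteq> 0" for u
  proof -
    let ?x = "vjoin u (0 :: real ^ 'm)"
    have "?x \<noteq> 0" using that by (simp add: vjoin_eq_0_iff)
    then have "?x \<bullet> (map_matrix Im (siegel_point Z W T) *v ?x) > 0"
      using P by (simp add: siegel_upper_def)
    then show ?thesis by (simp add: matrix_vjoin inner_vjoin blk_map_matrix)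
  qed
  moreover have "transpose Z = Z"
    using P siegel_point_sym_iff by (auto simp: siegel_upper_def)
  ultimately show ?thesis by (simp add: siegel_upper_def)
qed

lemma inner_transpose_matrix:
  fixes A :: "real ^ 'n ^ 'm"
  shows "x \<bullet> (transpose A *v y) = (A *v x) \<bullet> y"
  by (metis dot_lmul_matrix transpose_transpose vector_transpose_matrix)

text \<open>
  With \<open>Y = Im Z\<close> and \<open>V = Im W\<close>, completing the square shows that the imaginary part of
  \<open>(Z, W, T)\<close> is positive definite as soon as \<open>Im T\<close> exceeds \<open>V Y\<^sup>-\<^sup>1\<close> times the transpose of
  \<open>V\<close> (the Schur complement). The choice here is this matrix plus the identity.
\<close>

lemma siegel_point_upper_exists:
  fixes Z :: "complex ^ 'n ^ 'n::finite" and W :: "complex ^ 'n ^ 'm::finite"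
  assumes Z: "Z \<in> siegel_upper"
  shows "\<exists>T. siegel_point Z W T \<in> siegel_upper"
proof -
  define Y where "Y = map_matrix Im Z"
  define V where "V = map_matrix Im W"
  have symZ: "transpose Z = Z" using Z by (simp add: siegel_upper_def)
  have symY: "transpose Y = Y"
    using arg_cong[OF symZ, of "map_matrix Im"] by (simp add: Y_def transpose_def vec_eq_iff)
  have pos: "u \<bullet> (Y *v u) > 0" if "u \<noteq> 0" for u
    using Z that by (simp add: siegel_upper_def Y_def)
  have nonneg: "u \<bullet> (Y *v u) \<ge> 0" for u
    using pos[of u] by (cases "u = 0") auto
  have invY: "invertible Y"
    unfolding invertible_left_inverse matrix_left_invertible_ker using pos by fastforce
  define M where "M = matrix_inv Y ** transpose V"
  have YM: "transpose V = Y ** M"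
    by (simp add: M_def matrix_mul_assoc matrix_inv(1)[OF invY])
  have V: "V = transpose M ** Y"
    using arg_cong[OF YM, of transpose] by (simp add: matrix_transpose_mul symY)
  \<comment> \<open>Since \<open>Y ** M\<close> is the transpose of \<open>V\<close>, the first summand is \<open>V\<close> times the inverse of \<open>Y\<close>
    times the transpose of \<open>V\<close>, written so that its symmetry is evident.\<close>
  define S where "S = transpose M ** Y ** M + mat 1"
  define T where "T = map_matrix (\<lambda>t. \<i> * of_real t) S"
  have symS: "transpose S = S"
    by (simp add: S_def transpose_add matrix_transpose_mul symY matrix_mul_assoc)
  have symT: "transpose T = T"
    using symS by (simp add: T_def transpose_def vec_eq_iff)
  have ImT: "map_matrix Im T = S" by (simp add: T_def vec_eq_iff)
  have ImWt: "map_matrix Im (transpose W) = Y ** M"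
    by (simp add: YM[symmetric] V_def vec_eq_iff transpose_def)
  have "x \<bullet> (map_matrix Im (siegel_point Z W T) *v x) > 0" if "x \<noteq> 0" for x
  proof -
    obtain u v where x: "x = vjoin u v" by (rule vjoin_cases)
    define w where "w = M *v v"
    have "x \<bullet> (map_matrix Im (siegel_point Z W T) *v x)
      = u \<bullet> (Y *v u + (Y ** M) *v v) + v \<bullet> ((transpose M ** Y) *v u + S *v v)"
      by (simp add: x matrix_vjoin inner_vjoin blk_map_matrix ImT ImWt Y_def[symmetric] V_def[symmetric] V[symmetric])
    also have "\<dots> = (u + w) \<bullet> (Y *v (u + w)) + v \<bullet> v"
      by (simp add: S_def w_def matrix_vector_mult_add_rdistrib matrix_vector_right_distrib
          inner_add_left inner_add_right matrix_vector_mul_assoc[symmetric] inner_transpose_matrix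
          del: transpose_matrix_vector)
    also have "\<dots> > 0"
    proof (cases "v = 0")
      case True
      then show ?thesis using that pos[of u] by (simp add: x w_def vjoin_eq_0_iff)
    next
      case False
      then show ?thesis using nonneg[of "u + w"] by (simp add: add_nonneg_pos)
    qed
    finally show ?thesis .
  qed
  then have "siegel_point Z W T \<in> siegel_upper"
    using symZ symT by (simp add: siegel_upper_def siegel_point_sym_iff)
  then show ?thesis ..
qed


section \<open>The decomposition of the action of the Jacobi group\<close>

lemma jacobi_group_symplectic:
  "g \<in> carrier jacobi_group \<Longrightarrow> g \<in> carrier symplectic_group"
  by (simp add: jacobi_group_def)

definition right_mult_op :: "complex ^ 'n ^ 'n \<Rightarrow> ('n::finite, 'm::finite) mat_op"
  where "right_mult_op N = Blinfun (\<lambda>W. W ** N)"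

lemma right_mult_op_apply [simp]:
  fixes W :: "complex ^ 'n ^ 'm"
  shows "blinfun_apply (right_mult_op N) W = W ** N"
proof -
  have "linear (\<lambda>W :: complex ^ 'n ^ 'm. W ** N)"
    by (rule linearI) (simp_all add: matrix_add_rdistrib scalar_matrix_assoc)
  then show ?thesis
    by (simp add: right_mult_op_def bounded_linear_Blinfun_apply linear_conv_bounded_linear)
qed

lemma right_mult_op_in_GL_mat:
  assumes "invertible N"
  shows "(right_mult_op N :: ('n::finite, 'm::finite) mat_op) \<in> carrier GL_mat"
proof -
  have "bij (\<lambda>W :: complex ^ 'n ^ 'm. W ** N)"
    by (rule o_bij[of "\<lambda>W. W ** matrix_inv N"])
      (simp_all add: fun_eq_iff matrix_mul_assoc[symmetric] matrix_inv[OF assms])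
  moreover have "cscale z W ** N = cscale z (W ** N)" for z and W :: "complex ^ 'n ^ 'm"
    by (simp add: cscale_def vec_eq_iff matrix_matrix_mult_def sum_distrib_left mult.assoc)
  moreover have "blinfun_apply (right_mult_op N) = (\<lambda>W :: complex ^ 'n ^ 'm. W ** N)"
    by (simp add: fun_eq_iff)
  ultimately show ?thesis by (simp add: GL_mat_def)
qed

lemma invertible_matrix_inv: "invertible A \<Longrightarrow> invertible (matrix_inv A)"
  using matrix_inv by (auto simp: invertible_def)

text \<open>
  The denominator of \<open>g\<close> at \<open>(Z, W, T)\<close> is block upper triangular with diagonal blocks
  \<open>C Z + D\<close> and the identity, so the first block column and the lower right block of the
  image \<open>Q\<close> can be read off from (\<open>Q\<close> times denominator) = numerator without inverting a
  block matrix. The remaining block is determined because \<open>Q\<close>, as a point of the half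
  plane, is symmetric.
\<close>

lemma jacobi_decomposition_exists:
  fixes g :: "('n::finite, 'm::finite) jacobi_matrix"
  assumes g: "g \<in> carrier jacobi_group"
  shows "\<exists>s a b c. jacobi_decomposition g s a b c"
proof -
  obtain \<sigma> lam mu kappa where \<sigma>: "\<sigma> \<in> carrier symplectic_group"
    and g_eq: "g = jacobi_mat \<sigma> lam mu kappa"
    using g by (auto simp: jacobi_group_def)
  note gs = jacobi_group_symplectic[OF g]
  define L M K where "L = cmat lam" "M = cmat mu" "K = cmat kappa"
  define R where "R Z = matrix_inv (siegel_den \<sigma> Z)" for Z
  \<comment> \<open>The upper right block of the denominator.\<close>
  define X where "X W = cmat (blk21 \<sigma>) ** transpose W
    + cmat (blk21 \<sigma> ** transpose mu - blk22 \<sigma> ** transpose lam)" for W :: "complex ^ 'n ^ 'm"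
  define s where "s Z = siegel_num \<sigma> Z ** R Z" for Z
  define a where "a Z = (right_mult_op (R Z) :: ('n, 'm) mat_op)" for Z
  define b where "b Z = (L ** Z + M) ** R Z" for Z
  define c where "c Z W = L ** transpose W + K - (W ** R Z + b Z) ** X W" for Z W
  have "siegel_act g (siegel_point Z W T) = siegel_point (s Z) (blinfun_apply (a Z) W + b Z) (T + c Z W)"
    if P: "siegel_point Z W T \<in> siegel_upper" for Z W T
  proof -
    define Q where "Q = siegel_act g (siegel_point Z W T)"
    have Z: "Z \<in> siegel_upper" using P by (rule siegel_point_upper_left)
    note inv = siegel_den_invertible[OF \<sigma> Z]
    note eq = siegel_act_den[OF gs P, folded Q_def]
    have den: "blk11 (siegel_den g (siegel_point Z W T)) = siegel_den \<sigma> Z"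
      "blk12 (siegel_den g (siegel_point Z W T)) = X W"
      "blk21 (siegel_den g (siegel_point Z W T)) = 0"
      "blk22 (siegel_den g (siegel_point Z W T)) = mat 1"
      by (simp_all add: siegel_den_def g_eq jacobi_mat_def Let_def blk_add blk_mult blk_map_matrix
          cmat_hom X_def)
    have num: "blk11 (siegel_num g (siegel_point Z W T)) = siegel_num \<sigma> Z"
      "blk21 (siegel_num g (siegel_point Z W T)) = L ** Z + W + M"
      "blk22 (siegel_num g (siegel_point Z W T)) = L ** transpose W + T + K"
      by (simp_all add: siegel_num_def g_eq jacobi_mat_def Let_def blk_add blk_mult blk_map_matrix
          cmat_hom L_M_K_def)
    have e: "blk11 Q ** siegel_den \<sigma> Z = siegel_num \<sigma> Z"
      "blk21 Q ** siegel_den \<sigma> Z = L ** Z + W + M"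
      "blk21 Q ** X W + blk22 Q = L ** transpose W + T + K"
      using arg_cong[OF eq, of blk11] arg_cong[OF eq, of blk21] arg_cong[OF eq, of blk22]
      by (simp_all add: blk_mult den num)
    have "blk11 Q = s Z"
      using eq_mult_matrix_inv[OF inv e(1)] by (simp add: s_def R_def)
    moreover have Q21: "blk21 Q = blinfun_apply (a Z) W + b Z"
      using eq_mult_matrix_inv[OF inv e(2)]
      by (simp add: a_def b_def R_def matrix_add_rdistrib add_ac)
    moreover have "blk22 Q = L ** transpose W + T + K - blk21 Q ** X W"
      using e(3) by (simp add: eq_diff_eq add.commute)
    then have "blk22 Q = T + c Z W" by (simp add: Q21 c_def a_def)
    moreover have "Q = siegel_point (blk11 Q) (blk21 Q) (blk22 Q)"
      unfolding Q_def by (intro siegel_upper_eq_siegel_point siegel_act_in_upper gs P)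
    ultimately show ?thesis by (simp add: Q_def)
  qed
  moreover have "a Z \<in> carrier GL_mat" if "Z \<in> siegel_upper" for Z
    unfolding a_def R_def
    by (intro right_mult_op_in_GL_mat invertible_matrix_inv siegel_den_invertible \<sigma> that)
  ultimately have "jacobi_decomposition g s a b c" by (simp add: jacobi_decomposition_def)
  then show ?thesis by blast
qed

text \<open>
  Stated for any matrix with a decomposition, so that it applies to a product of elements
  of the Jacobi group directly through the composed data.
\<close>

lemma jacobi_decomposition_data:
  assumes "jacobi_decomposition g s a b c"
  shows "jacobi_decomposition g (jacobi_sigma g) (jacobi_a g) (jacobi_b g) (jacobi_c g)"
proof -
  have "case jacobi_data g of (s, a, b, c) \<Rightarrow> jacobi_decomposition g s a b c"
    unfolding jacobi_data_def by (rule someI[of _ "(s, a, b, c)"]) (simp add: assms)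
  then show ?thesis
    by (simp add: jacobi_sigma_def jacobi_a_def jacobi_b_def jacobi_c_def split: prod.splits)
qed

text \<open>
  Equality of \<open>siegel_point\<close>s over a given \<open>(Z, W)\<close> can be read off blockwise; the case
  \<open>W = 0\<close> separates the translation part \<open>b\<close> from the linear part \<open>a\<close>.
\<close>

lemma jacobi_decomposition_unique:
  assumes d: "jacobi_decomposition g s a b c" and d': "jacobi_decomposition g s' a' b' c'"
    and Z: "Z \<in> siegel_upper"
  shows "s Z = s' Z" "a Z = a' Z" "b Z = b' Z" "c Z W = c' Z W"
proof -
  have eq: "s Z = s' Z \<and> blinfun_apply (a Z) W + b Z = blinfun_apply (a' Z) W + b' Z \<and> c Z W = c' Z W"
    for W
  proof -
    obtain T where P: "siegel_point Z W T \<in> siegel_upper" using siegel_point_upper_exists[OF Z] by blast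
    have "siegel_point (s Z) (blinfun_apply (a Z) W + b Z) (T + c Z W)
        = siegel_point (s' Z) (blinfun_apply (a' Z) W + b' Z) (T + c' Z W)"
      using d d' P unfolding jacobi_decomposition_def by metis
    then show ?thesis by simp
  qed
  show "s Z = s' Z" "c Z W = c' Z W" using eq by blast+
  show b: "b Z = b' Z" using eq[of 0] by simp
  show "a Z = a' Z" by (rule blinfun_eqI) (use eq b in auto)
qed

lemma jacobi_decomposition_sigma_upper:
  fixes g :: "('n::finite, 'm::finite) jacobi_matrix"
  assumes g: "g \<in> carrier symplectic_group" and d: "jacobi_decomposition g s a b c"
    and Z: "Z \<in> siegel_upper"
  shows "s Z \<in> siegel_upper"
proof -
  obtain T where P: "siegel_point Z (0 :: complex ^ 'n ^ 'm) T \<in> siegel_upper"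
    using siegel_point_upper_exists[OF Z] by blast
  have "siegel_act g (siegel_point Z 0 T) \<in> siegel_upper" by (rule siegel_act_in_upper[OF g P])
  then show ?thesis using d P by (auto simp: jacobi_decomposition_def intro: siegel_point_upper_left)
qed

lemma GL_mat_compose:
  assumes "A \<in> carrier GL_mat" "B \<in> carrier GL_mat"
  shows "A o\<^sub>L B \<in> carrier GL_mat"
proof -
  have "bij (blinfun_apply A \<circ> blinfun_apply B)"
    using assms by (intro bij_comp) (simp_all add: GL_mat_def)
  moreover have "blinfun_apply (A o\<^sub>L B) = blinfun_apply A \<circ> blinfun_apply B"
    by (simp add: fun_eq_iff)
  ultimately show ?thesis using assms by (simp add: GL_mat_def)
qed

lemma jacobi_decomposition_mult:
  fixes g1 g2 :: "('n::finite, 'm::finite) jacobi_matrix"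
  assumes g1: "g1 \<in> carrier symplectic_group" and g2: "g2 \<in> carrier symplectic_group"
    and d1: "jacobi_decomposition g1 s1 a1 b1 c1" and d2: "jacobi_decomposition g2 s2 a2 b2 c2"
  shows "jacobi_decomposition (g1 ** g2) (\<lambda>Z. s1 (s2 Z)) (\<lambda>Z. a1 (s2 Z) o\<^sub>L a2 Z)
    (\<lambda>Z. blinfun_apply (a1 (s2 Z)) (b2 Z) + b1 (s2 Z))
    (\<lambda>Z W. c1 (s2 Z) (blinfun_apply (a2 Z) W + b2 Z) + c2 Z W)"
  unfolding jacobi_decomposition_def
proof (intro conjI ballI allI impI)
  fix Z :: "complex ^ 'n ^ 'n" assume Z: "Z \<in> siegel_upper"
  show "a1 (s2 Z) o\<^sub>L a2 Z \<in> carrier GL_mat"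
    using d1 d2 Z jacobi_decomposition_sigma_upper[OF g2 d2 Z]
    by (auto simp: jacobi_decomposition_def intro: GL_mat_compose)
next
  fix Z :: "complex ^ 'n ^ 'n" and W :: "complex ^ 'n ^ 'm" and T
  assume P: "siegel_point Z W T \<in> siegel_upper"
  have 2: "siegel_act g2 (siegel_point Z W T)
      = siegel_point (s2 Z) (blinfun_apply (a2 Z) W + b2 Z) (T + c2 Z W)"
    using d2 P by (simp add: jacobi_decomposition_def)
  have "siegel_act g2 (siegel_point Z W T) \<in> siegel_upper" by (rule siegel_act_in_upper[OF g2 P])
  then have "siegel_act g1 (siegel_act g2 (siegel_point Z W T))
      = siegel_point (s1 (s2 Z)) (blinfun_apply (a1 (s2 Z)) (blinfun_apply (a2 Z) W + b2 Z) + b1 (s2 Z))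
         (T + c2 Z W + c1 (s2 Z) (blinfun_apply (a2 Z) W + b2 Z))"
    using d1 unfolding 2 by (simp add: jacobi_decomposition_def)
  then show "siegel_act (g1 ** g2) (siegel_point Z W T)
      = siegel_point (s1 (s2 Z))
         (blinfun_apply (a1 (s2 Z) o\<^sub>L a2 Z) W + (blinfun_apply (a1 (s2 Z)) (b2 Z) + b1 (s2 Z)))
         (T + (c1 (s2 Z) (blinfun_apply (a2 Z) W + b2 Z) + c2 Z W))"
    by (simp add: siegel_act_mult[OF g1 g2 P] blinfun.add_right add_ac)
qed

lemma jacobi_group_decomposition:
  assumes "g \<in> carrier jacobi_group"
  shows "jacobi_decomposition g (jacobi_sigma g) (jacobi_a g) (jacobi_b g) (jacobi_c g)"
  using jacobi_decomposition_exists[OF assms] jacobi_decomposition_data by blast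

lemma jacobi_sigma_upper:
  assumes g: "g \<in> carrier jacobi_group" and Z: "Z \<in> siegel_upper"
  shows "jacobi_sigma g Z \<in> siegel_upper"
  using jacobi_decomposition_sigma_upper[OF jacobi_group_symplectic[OF g] jacobi_group_decomposition[OF g] Z] .

text \<open>
  By uniqueness, the data of \<open>g1 ** g2\<close> agree with the composed data of \<open>g1\<close> and \<open>g2\<close>.
\<close>

lemma jacobi_cocycle:
  fixes g1 g2 :: "('n::finite, 'm::finite) jacobi_matrix"
  assumes g1: "g1 \<in> carrier jacobi_group" and g2: "g2 \<in> carrier jacobi_group"
    and Z: "Z \<in> siegel_upper"
  shows "jacobi_a (g1 ** g2) Z = jacobi_a g1 (jacobi_sigma g2 Z) o\<^sub>L jacobi_a g2 Z"
    and "jacobi_c (g1 ** g2) Z W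
      = jacobi_c g1 (jacobi_sigma g2 Z) (blinfun_apply (jacobi_a g2 Z) W + jacobi_b g2 Z) + jacobi_c g2 Z W"
proof -
  note d = jacobi_decomposition_mult[OF jacobi_group_symplectic[OF g1] jacobi_group_symplectic[OF g2]
      jacobi_group_decomposition[OF g1] jacobi_group_decomposition[OF g2]]
  note u = jacobi_decomposition_unique[OF jacobi_decomposition_data[OF d] d Z]
  show "jacobi_a (g1 ** g2) Z = jacobi_a g1 (jacobi_sigma g2 Z) o\<^sub>L jacobi_a g2 Z"
    by (rule u(2))
  show "jacobi_c (g1 ** g2) Z W
      = jacobi_c g1 (jacobi_sigma g2 Z) (blinfun_apply (jacobi_a g2 Z) W + jacobi_b g2 Z) + jacobi_c g2 Z W"
    by (rule u(4))
qed


section \<open>Factors of automorphy\<close>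

lemma jacobi_a_K_complex:
  assumes "g \<in> carrier jacobi_group" "Z \<in> siegel_upper"
  shows "jacobi_a g Z \<in> carrier K_complex"
  using assms by (auto simp: K_complex_def intro!: generate.incl)

lemma rep_jacobi_a_in_GL_space:
  assumes "holomorphic_rep s \<rho>" "K_lie_iso \<Phi>" "g \<in> carrier jacobi_group" "Z \<in> siegel_upper"
  shows "\<rho> (\<Phi> (jacobi_a g Z)) \<in> carrier (GL_space s)"
  using assms jacobi_a_K_complex[OF assms(3,4)]
  by (auto simp: holomorphic_rep_def K_lie_iso_def iso_def hom_def)

lemma rep_jacobi_a_mult:
  fixes g1 g2 :: "('n::finite, 'm::finite) jacobi_matrix"
  assumes rep: "holomorphic_rep s \<rho>" and iso: "K_lie_iso \<Phi>"
    and g1: "g1 \<in> carrier jacobi_group" and g2: "g2 \<in> carrier jacobi_group" and Z: "Z \<in> siegel_upper"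
  shows "\<rho> (\<Phi> (jacobi_a (g1 ** g2) Z))
    = \<rho> (\<Phi> (jacobi_a g1 (jacobi_sigma g2 Z))) \<circ> \<rho> (\<Phi> (jacobi_a g2 Z))"
proof -
  let ?A1 = "jacobi_a g1 (jacobi_sigma g2 Z)" and ?A2 = "jacobi_a g2 Z"
  have K: "?A1 \<in> carrier K_complex" "?A2 \<in> carrier K_complex"
    using jacobi_a_K_complex g1 g2 Z jacobi_sigma_upper by blast+
  have "\<Phi> \<in> hom K_complex GL_n" using iso by (simp add: K_lie_iso_def iso_def)
  then have "\<Phi> (?A1 \<otimes>\<^bsub>K_complex\<^esub> ?A2) = \<Phi> ?A1 \<otimes>\<^bsub>GL_n\<^esub> \<Phi> ?A2"
    and GL: "\<Phi> ?A1 \<in> carrier GL_n" "\<Phi> ?A2 \<in> carrier GL_n"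
    using K by (auto simp: hom_def)
  moreover have "\<rho> \<in> hom GL_n (GL_space s)" using rep by (simp add: holomorphic_rep_def)
  then have "\<rho> (\<Phi> ?A1 \<otimes>\<^bsub>GL_n\<^esub> \<Phi> ?A2) = \<rho> (\<Phi> ?A1) \<otimes>\<^bsub>GL_space s\<^esub> \<rho> (\<Phi> ?A2)"
    using GL by (auto simp: hom_def)
  ultimately show ?thesis
    by (simp add: jacobi_cocycle(1)[OF g1 g2 Z] K_complex_def GL_mat_def GL_space_def)
qed

lemma scale_in_GL_space:
  assumes "vector_space s" and f: "f \<in> carrier (GL_space s)" and z: "z \<noteq> 0"
  shows "(\<lambda>v. s z (f v)) \<in> carrier (GL_space s)"
proof -
  interpret vector_space s by fact
  have "Vector_Spaces.linear s s (\<lambda>v. s z (f v))"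
    using f unfolding GL_space_def Vector_Spaces.linear_def module_hom_iff
    by (simp add: scale_right_distrib mult.commute)
  moreover have "bij (s z)"
    by (rule o_bij[of "s (inverse z)"]) (simp_all add: fun_eq_iff z)
  then have "bij (s z \<circ> f)" using f by (intro bij_comp) (simp_all add: GL_space_def)
  ultimately show ?thesis by (simp add: GL_space_def comp_def)
qed

theorem lemma2p3:
  fixes scaleV :: "complex \<Rightarrow> 'v::ab_group_add \<Rightarrow> 'v"
    and BasisV :: "'v set"
    and \<Phi> :: "('n::finite, 'm::finite) mat_op \<Rightarrow> complex ^ 'n ^ 'n"
    and \<rho> :: "complex ^ 'n ^ 'n \<Rightarrow> 'v \<Rightarrow> 'v"
    and chi :: "complex ^ 'm ^ 'm \<Rightarrow> complex"
  assumes "finite_dimensional_vector_space scaleV BasisV"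
    and "holomorphic_rep scaleV \<rho>"
    and "K_lie_iso \<Phi>"
    and "additive_character chi"
  shows "factor_of_automorphy
           (tilde_group :: ('n, 'm) jacobi_matrix monoid)
           siegel_upper jacobi_sigma (GL_space scaleV)
           (\<lambda>g Z. \<rho> (\<Phi> (jacobi_a g Z)))
       \<and> factor_of_automorphy
           (jacobi_group :: ('n, 'm) jacobi_matrix monoid)
           jacobi_space jacobi_act (GL_space scaleV)
           (\<lambda>g (Z, W) v. scaleV (chi (jacobi_c g Z W)) (\<rho> (\<Phi> (jacobi_a g Z)) v))"
proof
  note in_GL = rep_jacobi_a_in_GL_space[OF assms(2,3)]
  note mult = rep_jacobi_a_mult[OF assms(2,3)]
  interpret finite_dimensional_vector_space scaleV BasisV by fact
  have vs: "vector_space scaleV" by (rule vector_space_axioms)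
  have chi: "chi T \<noteq> 0" "chi (S + T) = chi S * chi T" for S T
    using assms(4) by (simp_all add: additive_character_def)
  have group_mult: "g1 \<otimes>\<^bsub>jacobi_group\<^esub> g2 = g1 ** g2" for g1 g2 :: "('n, 'm) jacobi_matrix"
    by (simp add: jacobi_group_def symplectic_group_def)
  have tilde_mult: "g1 \<otimes>\<^bsub>tilde_group\<^esub> g2 = g1 ** g2" for g1 g2 :: "('n, 'm) jacobi_matrix"
    using group_mult by (simp add: tilde_group_def)
  have tilde: "g \<in> carrier jacobi_group" if "g \<in> carrier tilde_group" for g :: "('n, 'm) jacobi_matrix"
    using that by (simp add: tilde_group_def)
  show "factor_of_automorphy (tilde_group :: ('n, 'm) jacobi_matrix monoid)
      siegel_upper jacobi_sigma (GL_space scaleV) (\<lambda>g Z. \<rho> (\<Phi> (jacobi_a g Z)))"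
    unfolding factor_of_automorphy_def
  proof (intro conjI ballI)
    fix g :: "('n, 'm) jacobi_matrix" and Z :: "complex ^ 'n ^ 'n"
    assume "g \<in> carrier tilde_group" "Z \<in> siegel_upper"
    then show "\<rho> (\<Phi> (jacobi_a g Z)) \<in> carrier (GL_space scaleV)"
      by (intro in_GL tilde)
  next
    fix g1 g2 :: "('n, 'm) jacobi_matrix" and Z :: "complex ^ 'n ^ 'n"
    assume "g1 \<in> carrier tilde_group" "g2 \<in> carrier tilde_group" "Z \<in> siegel_upper"
    then show "\<rho> (\<Phi> (jacobi_a (g1 \<otimes>\<^bsub>tilde_group\<^esub> g2) Z))
        = \<rho> (\<Phi> (jacobi_a g1 (jacobi_sigma g2 Z))) \<otimes>\<^bsub>GL_space scaleV\<^esub> \<rho> (\<Phi> (jacobi_a g2 Z))"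
      using mult[OF tilde tilde] by (simp add: tilde_mult GL_space_def)
  qed
  show "factor_of_automorphy (jacobi_group :: ('n, 'm) jacobi_matrix monoid)
      jacobi_space jacobi_act (GL_space scaleV)
      (\<lambda>g (Z, W) v. scaleV (chi (jacobi_c g Z W)) (\<rho> (\<Phi> (jacobi_a g Z)) v))"
    unfolding factor_of_automorphy_def jacobi_space_def
  proof (intro conjI ballI; clarify)
    fix g :: "('n, 'm) jacobi_matrix" and Z :: "complex ^ 'n ^ 'n" and W :: "complex ^ 'n ^ 'm"
    assume "g \<in> carrier jacobi_group" "Z \<in> siegel_upper"
    then show "(\<lambda>v. scaleV (chi (jacobi_c g Z W)) (\<rho> (\<Phi> (jacobi_a g Z)) v)) \<in> carrier (GL_space scaleV)"
      by (intro scale_in_GL_space vs in_GL chi(1))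
  next
    fix g1 g2 :: "('n, 'm) jacobi_matrix" and Z :: "complex ^ 'n ^ 'n" and W :: "complex ^ 'n ^ 'm"
    assume g1: "g1 \<in> carrier jacobi_group" and g2: "g2 \<in> carrier jacobi_group" and Z: "Z \<in> siegel_upper"
    let ?f = "\<rho> (\<Phi> (jacobi_a g1 (jacobi_sigma g2 Z)))"
    have "?f \<in> carrier (GL_space scaleV)"
      by (intro in_GL g1 jacobi_sigma_upper g2 Z)
    \<comment> \<open>The scalar \<open>\<chi>(c(g\<^sub>2; Z, W))\<close> has to move past the operator of \<open>g\<^sub>1\<close>.\<close>
    then have "?f (scaleV z v) = scaleV z (?f v)" for z v
      by (simp add: GL_space_def Vector_Spaces.linear_def module_hom_iff)
    then show "(\<lambda>v. scaleV (chi (jacobi_c (g1 \<otimes>\<^bsub>jacobi_group\<^esub> g2) Z W))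
          (\<rho> (\<Phi> (jacobi_a (g1 \<otimes>\<^bsub>jacobi_group\<^esub> g2) Z)) v))
      = (case jacobi_act g2 (Z, W) of (Z, W) \<Rightarrow>
          \<lambda>v. scaleV (chi (jacobi_c g1 Z W)) (\<rho> (\<Phi> (jacobi_a g1 Z)) v))
        \<otimes>\<^bsub>GL_space scaleV\<^esub> (\<lambda>v. scaleV (chi (jacobi_c g2 Z W)) (\<rho> (\<Phi> (jacobi_a g2 Z)) v))"
      by (simp add: group_mult mult[OF g1 g2 Z] jacobi_cocycle(2)[OF g1 g2 Z] chi(2)
          jacobi_act_def GL_space_def fun_eq_iff)
  qed
qed

end
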